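(* Let $m,n\ge 1$ be integers and let $K_{n,n,\dots,n}$ be the complete $m$-partite graph with parts $V_1,\dots,V_m$, each of cardinality $n$ (vertices are adjacent iff they lie in different parts). Let $\mathcal{A}=\mathcal{A}_1\cup\cdots\cup\mathcal{A}_m$ be a disjoint union with $|\mathcal{A}_i|=n$, and let $\mathcal{W}_m(n)$ be the set of words $w=w_1\cdots w_{mn}$ over $\mathcal{A}$ such that each letter of $\mathcal{A}$ appears exactly once, consecutive letters lie in different sets $\mathcal{A}_i$, and the first and last letters lie in different sets $\mathcal{A}_i$; put $W_m(n)=|\mathcal{W}_m(n)|$. Let $S_m(n)$ be the number of words of length $mn$ over $[m]$ using each color exactly $n$ times, with no two consecutive equal letters and with distinct first and last letters. Then: (1) there is a bijection between $\mathcal{W}_m(n)$ and the directed Hamiltonian paths in $K_{n,n,\dots,n}$ whose two endpoints lie in distinct parts; (2) each undirected Hamiltonian cycle in $K_{n,n,\dots,n}$ corresponds to exactly $2mn$ such directed paths. Consequently, the number $H_m(n)$ of undirected Hamiltonian cycles in $K_{n,n,\dots,n}$ satisfies \[ H_m(n)=\frac{W_m(n)}{2mn}=\frac{(n!)^m}{2mn}\,S_m(n). \]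
   Context: A directed Hamiltonian path is a sequence $v_1,\dots,v_{mn}$ listing every vertex exactly once with $v_t v_{t+1}$ an edge for all $t$.
   Formalization: The equality H_m(n) = W_m(n)/(2mn) is stated only for (m,n) ≠ (2,1), since for (2,1) it would give H = 2/4 = 1/2, not an integer; (1), (2) and W_m(n)/(2mn) = (n!)^m S_m(n)/(2mn) are stated for all m,n ≥ 1. *)

theory Defs
  imports Complex_Main "HOL-Library.Disjoint_Sets"
begin

text \<open>
  A family of \<open>m\<close> pairwise disjoint sets \<open>A 1, \<dots>, A m\<close>, each of cardinality \<open>n\<close>. It serves both
  for the alphabets and for the parts of the graph. For \<open>n = 0\<close> infinite classes would also be
  allowed, since \<open>card\<close> is then \<open>0\<close>; only \<open>n \<ge> 1\<close> is used.
\<close>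

definition equal_classes :: "nat \<Rightarrow> nat \<Rightarrow> (nat \<Rightarrow> 'a set) \<Rightarrow> bool" where
  "equal_classes m n A \<longleftrightarrow> disjoint_family_on A {1..m} \<and> (\<forall>i\<in>{1..m}. card (A i) = n)"

definition ground :: "nat \<Rightarrow> (nat \<Rightarrow> 'a set) \<Rightarrow> 'a set" where
  "ground m A = (\<Union>i\<in>{1..m}. A i)"

definition in_diff_classes :: "nat \<Rightarrow> (nat \<Rightarrow> 'a set) \<Rightarrow> 'a \<Rightarrow> 'a \<Rightarrow> bool" where
  "in_diff_classes m A x y \<longleftrightarrow> (\<exists>i\<in>{1..m}. \<exists>j\<in>{1..m}. i \<noteq> j \<and> x \<in> A i \<and> y \<in> A j)"

definition class_words :: "nat \<Rightarrow> nat \<Rightarrow> (nat \<Rightarrow> 'a set) \<Rightarrow> 'a list set" where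
  "class_words m n A =
     {w. length w = m * n \<and> set w \<subseteq> ground m A \<and> (\<forall>a\<in>ground m A. count_list w a = 1) \<and>
         successively (in_diff_classes m A) w \<and> in_diff_classes m A (hd w) (last w)}"

definition color_words :: "nat \<Rightarrow> nat \<Rightarrow> nat list set" where
  "color_words m n =
     {w. length w = m * n \<and> set w \<subseteq> {1..m} \<and> (\<forall>c\<in>{1..m}. count_list w c = n) \<and>
         successively (\<noteq>) w \<and> hd w \<noteq> last w}"

text \<open>
  A simple graph is given by a vertex set and a set of edges, each edge being an unordered pair
  \<open>{u, v}\<close> of distinct vertices.
\<close>

definition multipartite_edges :: "nat \<Rightarrow> (nat \<Rightarrow> 'v set) \<Rightarrow> 'v set set" where
  "multipartite_edges m V = {{u, v} | u v. in_diff_classes m V u v}"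

definition directed_ham_path :: "'v set \<Rightarrow> 'v set set \<Rightarrow> 'v list \<Rightarrow> bool" where
  "directed_ham_path Vs Es p \<longleftrightarrow>
     distinct p \<and> set p = Vs \<and> successively (\<lambda>u v. {u, v} \<in> Es) p"

text \<open>
  The edges traversed by a vertex sequence, including the closing edge from the last vertex back
  to the first.
\<close>

definition closed_edges :: "'v list \<Rightarrow> 'v set set" where
  "closed_edges p = {{p ! t, p ! (Suc t mod length p)} | t. t < length p}"

text \<open>
  An undirected Hamiltonian cycle is a spanning subgraph that is a cycle; being spanning, it is
  determined by its edge set \<open>C\<close>, so that rotations and reversals of a vertex sequence give the
  same cycle. As usual for simple graphs, a cycle has at least three vertices.
\<close>

definition undirected_ham_cycle :: "'v set \<Rightarrow> 'v set set \<Rightarrow> 'v set set \<Rightarrow> bool" where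
  "undirected_ham_cycle Vs Es C \<longleftrightarrow>
     (\<exists>p. distinct p \<and> set p = Vs \<and> length p \<ge> 3 \<and> closed_edges p \<subseteq> Es \<and> C = closed_edges p)"

definition open_ham_paths :: "nat \<Rightarrow> (nat \<Rightarrow> 'v set) \<Rightarrow> 'v list set" where
  "open_ham_paths m V =
     {p. directed_ham_path (ground m V) (multipartite_edges m V) p \<and>
         in_diff_classes m V (hd p) (last p)}"

definition ham_cycles :: "nat \<Rightarrow> (nat \<Rightarrow> 'v set) \<Rightarrow> 'v set set set" where
  "ham_cycles m V = {C. undirected_ham_cycle (ground m V) (multipartite_edges m V) C}"

end

theory Submission
  imports Defs "HOL-Combinatorics.Multiset_Permutations"
begin

text \<open>
  A word over the alphabet amounts to its word of colours together with, for each colour, the order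
  in which the letters of that colour occur; this gives \<open>W = (n!)^m S\<close>. Read over the
  vertex set, the admissible words are exactly the open Hamiltonian paths. Finally, a sequence
  that traverses a given cycle is determined by its first two entries, and these may form any of the
  \<open>2 m n\<close> ordered pairs of neighbours on the cycle.
\<close>

section \<open>Words and colourings\<close>

text \<open>Disjointness makes the class index a function of the element. With this colouring, lying
  in different classes becomes inequality of colours.\<close>

lemma equal_classes_colouring:
  assumes "equal_classes m n A"
  obtains f where "\<And>i a. i \<in> {1..m} \<Longrightarrow> a \<in> A i \<Longrightarrow> f a = i"
proof
  fix i a assume i: "i \<in> {1..m}" "a \<in> A i"
  show "(THE i. i \<in> {1..m} \<and> a \<in> A i) = i"
  proof (rule the_equality)
    fix j assume "j \<in> {1..m} \<and> a \<in> A j"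
    with i assms show "j = i"
      unfolding equal_classes_def disjoint_family_on_def by blast
  qed (use i in simp)
qed

lemma in_diff_classes_iff:
  assumes "\<And>i a. i \<in> {1..m} \<Longrightarrow> a \<in> A i \<Longrightarrow> f a = i"
  shows "in_diff_classes m A x y \<longleftrightarrow> x \<in> ground m A \<and> y \<in> ground m A \<and> f x \<noteq> f y"
  using assms unfolding in_diff_classes_def ground_def by fastforce

lemma in_diff_classes_sym: "in_diff_classes m A x y \<Longrightarrow> in_diff_classes m A y x"
  unfolding in_diff_classes_def by metis

lemma ground_props:
  assumes "n \<ge> 1" "equal_classes m n A"
  shows "card (ground m A) = m * n" "\<And>i. i \<in> {1..m} \<Longrightarrow> finite (A i)"
proof -
  show fin: "finite (A i)" if "i \<in> {1..m}" for i
    using assms that unfolding equal_classes_def by (intro card_ge_0_finite) auto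
  have "card (ground m A) = (\<Sum>i\<in>{1..m}. card (A i))"
    unfolding ground_def using assms fin
    by (intro card_UN_disjoint) (auto simp: equal_classes_def disjoint_family_on_def)
  also have "\<dots> = m * n"
    using assms by (simp add: equal_classes_def)
  finally show "card (ground m A) = m * n" .
qed

lemma count_list_distinct: "distinct w \<Longrightarrow> a \<in> set w \<Longrightarrow> count_list w a = 1"
  by (induction w) auto

text \<open>Puts the words into the shape of \<open>directed_ham_path\<close>: a repetition-free
  enumeration of the ground set.\<close>

lemma class_words_eq:
  assumes "n \<ge> 1" "equal_classes m n A"
  shows "class_words m n A = {w. distinct w \<and> set w = ground m A \<and>
    successively (in_diff_classes m A) w \<and> in_diff_classes m A (hd w) (last w)}"
proof -
  have "(length w = m * n \<and> set w \<subseteq> ground m A \<and> (\<forall>a\<in>ground m A. count_list w a = 1))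
    \<longleftrightarrow> distinct w \<and> set w = ground m A" (is "?L \<longleftrightarrow> ?R") for w
  proof
    assume L: ?L
    then have "ground m A \<subseteq> set w"
      by (metis count_list_0_iff subsetI zero_neq_one)
    with L have eq: "set w = ground m A" by blast
    \<comment> \<open>The length \<open>m * n\<close> equals the number of letters occurring, so
      none occurs twice.\<close>
    then have "distinct w"
      using L ground_props(1)[OF assms] by (simp add: card_distinct)
    with eq show ?R by blast
  next
    assume ?R
    then show ?L
      using ground_props(1)[OF assms] distinct_card[of w] count_list_distinct[of w] by auto
  qed
  then show ?thesis
    unfolding class_words_def by blast
qed

lemma finite_class_words:
  assumes "n \<ge> 1" "equal_classes m n A"
  shows "finite (class_words m n A)"
  by (rule finite_subset[OF _ finite_permutations_of_set[of "ground m A"]])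
    (auto simp: class_words_eq[OF assms] permutations_of_set_def)

text \<open>Both words begin with the same colour, and the sublists of that colour begin with the
  two first letters, so these agree; removing them preserves the hypotheses. This gives injectivity
  of the decomposition.\<close>

lemma map_filter_eqD:
  assumes "map f w = map f w'" "\<And>i. i \<in> f ` set w \<Longrightarrow> filter (\<lambda>a. f a = i) w = filter (\<lambda>a. f a = i) w'"
  shows "w = w'"
  using assms
proof (induction w arbitrary: w')
  case (Cons x w)
  from Cons.prems(1) obtain y v where w': "w' = y # v" "f y = f x" "map f w = map f v"
    by auto
  have "x = y"
    using Cons.prems(2)[of "f x"] w' by simp
  moreover have "filter (\<lambda>a. f a = i) w = filter (\<lambda>a. f a = i) v" if "i \<in> f ` set w" for i
    using Cons.prems(2)[of i] w' that by (cases "f x = i") auto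
  ultimately show ?case
    using Cons.IH[of v] w' by simp
qed simp

lemma interleaving_exists:
  assumes "set c \<subseteq> I" "\<And>i. i \<in> I \<Longrightarrow> length (L i) = count_list c i"
    "\<And>i a. i \<in> I \<Longrightarrow> a \<in> set (L i) \<Longrightarrow> f a = i"
  shows "\<exists>w. map f w = c \<and> (\<forall>i\<in>I. filter (\<lambda>a. f a = i) w = L i)"
  using assms
proof (induction c arbitrary: L)
  case Nil
  then show ?case by (intro exI[of _ "[]"]) auto
next
  case (Cons k c)
  from Cons.prems(1,2) have k: "k \<in> I" and "length (L k) = Suc (count_list c k)"
    by auto
  then obtain x xs where L: "L k = x # xs" "length xs = count_list c k"
    by (auto simp: length_Suc_conv)
  have fx: "f x = k" using Cons.prems(3)[of k x] k L by simp
  have "\<exists>w. map f w = c \<and> (\<forall>i\<in>I. filter (\<lambda>a. f a = i) w = (L(k := xs)) i)"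
  proof (rule Cons.IH)
    show "length ((L(k := xs)) i) = count_list c i" if "i \<in> I" for i
      using Cons.prems(2)[OF that] L by auto
    show "f a = i" if "i \<in> I" "a \<in> set ((L(k := xs)) i)" for i a
      using Cons.prems(3)[OF that(1), of a] that(2) L by (auto split: if_splits)
  qed (use Cons.prems in auto)
  then obtain w where "map f w = c" "\<forall>i\<in>I. filter (\<lambda>a. f a = i) w = (L(k := xs)) i"
    by blast
  then show ?case
    using fx L by (intro exI[of _ "x # w"]) auto
qed

lemma card_class_words:
  assumes "m \<ge> 1" "n \<ge> 1" "equal_classes m n A"
  shows "card (class_words m n A) = fact n ^ m * card (color_words m n)"
proof -
  obtain f where f: "\<And>i a. i \<in> {1..m} \<Longrightarrow> a \<in> A i \<Longrightarrow> f a = i"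
    using equal_classes_colouring[OF assms(3)] by blast
  note W = class_words_eq[OF assms(2,3)] and ground = ground_props[OF assms(2,3)]
  have diff: "in_diff_classes m A x y \<longleftrightarrow> x \<in> ground m A \<and> y \<in> ground m A \<and> f x \<noteq> f y" for x y
    by (rule in_diff_classes_iff) (rule f)
  have f_ground: "a \<in> ground m A \<Longrightarrow> f a \<in> {1..m} \<and> a \<in> A (f a)" for a
    using f unfolding ground_def by auto
  have class_eq: "{a \<in> ground m A. f a = i} = A i" if "i \<in> {1..m}" for i
    using f_ground f[OF that] that by (auto simp: ground_def)
  have count_map: "count_list (map f w) i = length (filter (\<lambda>a. f a = i) w)" for w i
    by (induction w) auto
  have cardA: "card (A i) = n" if "i \<in> {1..m}" for i
    using assms(3) that by (simp add: equal_classes_def)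
  \<comment> \<open>The words are thus nonempty, so that \<open>hd\<close> and \<open>last\<close>
    are actual letters and commute with \<open>map f\<close>.\<close>
  have mn: "m * n \<noteq> 0" using assms(1,2) by simp
  define P where "P = (\<Pi>\<^sub>E i\<in>{1..m}. permutations_of_set (A i))"
  \<comment> \<open>The restriction to \<open>{1..m}\<close> makes the second component extensional,
    as membership in the product \<open>P\<close> requires.\<close>
  define F where "F w = (map f w, \<lambda>i\<in>{1..m}. filter (\<lambda>a. f a = i) w)" for w
  have succ_iff: "successively (in_diff_classes m A) w \<longleftrightarrow> successively (\<noteq>) (map f w)"
    if "set w \<subseteq> ground m A" for w
    unfolding successively_map using that by (intro successively_cong) (auto simp: diff)
  have ends_iff: "in_diff_classes m A (hd w) (last w) \<longleftrightarrow> hd (map f w) \<noteq> last (map f w)"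
    if "set w \<subseteq> ground m A" "w \<noteq> []" for w
    using that hd_in_set[of w] last_in_set[of w] by (auto simp: diff hd_map last_map)
  have "bij_betw F (class_words m n A) (color_words m n \<times> P)"
  proof (rule bij_betw_imageI)
    show "inj_on F (class_words m n A)"
    proof (rule inj_onI)
      fix w w' assume w: "w \<in> class_words m n A" and eq: "F w = F w'"
      show "w = w'"
      proof (rule map_filter_eqD[where f = f])
        fix i assume "i \<in> f ` set w"
        then have "i \<in> {1..m}" using w f_ground by (auto simp: W)
        then show "filter (\<lambda>a. f a = i) w = filter (\<lambda>a. f a = i) w'"
          using eq unfolding F_def prod.inject by (metis (no_types, lifting) restrict_apply')
      qed (use eq in \<open>simp add: F_def\<close>)
    qed
    show "F ` class_words m n A = color_words m n \<times> P"
    proof (intro equalityI subsetI)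
      fix z assume "z \<in> F ` class_words m n A"
      then obtain w where w: "w \<in> class_words m n A" and z: "z = F w" by blast
      have filt: "filter (\<lambda>a. f a = i) w \<in> permutations_of_set (A i)" if "i \<in> {1..m}" for i
        using w class_eq[OF that] by (intro permutations_of_setI) (auto simp: W)
      have len: "length w = m * n" using w unfolding class_words_def by blast
      then have "w \<noteq> []" using mn by auto
      have "map f w \<in> color_words m n"
        using w f_ground len succ_iff[of w] ends_iff[of w] \<open>w \<noteq> []\<close>
          length_finite_permutations_of_set[OF filt] cardA
        by (auto simp: W color_words_def count_map)
      moreover have "(\<lambda>i\<in>{1..m}. filter (\<lambda>a. f a = i) w) \<in> P"
        unfolding P_def using filt by (intro PiE_I) auto
      ultimately show "z \<in> color_words m n \<times> P"
        by (simp add: z F_def)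
    next
      fix z assume "z \<in> color_words m n \<times> P"
      then obtain c L where z: "z = (c, L)" and c: "c \<in> color_words m n" and L: "L \<in> P" by blast
      have perm: "L i \<in> permutations_of_set (A i)" if "i \<in> {1..m}" for i
        using L that unfolding P_def by (rule PiE_mem)
      have "\<exists>w. map f w = c \<and> (\<forall>i\<in>{1..m}. filter (\<lambda>a. f a = i) w = L i)"
      proof (rule interleaving_exists)
        show "length (L i) = count_list c i" if "i \<in> {1..m}" for i
          using length_finite_permutations_of_set[OF perm[OF that]] cardA[OF that] c that
          by (simp add: color_words_def)
        show "f a = i" if "i \<in> {1..m}" "a \<in> set (L i)" for i a
          using perm[OF that(1)] that f by (auto simp: permutations_of_set_def)
      qed (use c in \<open>simp add: color_words_def\<close>)
      then obtain w where w: "map f w = c" "\<forall>i\<in>{1..m}. filter (\<lambda>a. f a = i) w = L i"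
        by blast
      have len: "length w = m * n"
        using c unfolding w(1)[symmetric] by (simp add: color_words_def)
      then have "w \<noteq> []" using mn by auto
      \<comment> \<open>The sublist of colour \<open>i\<close> is \<open>L i\<close>, an enumeration
        of all of \<open>A i\<close>; hence no letter is missing from \<open>w\<close>.\<close>
      have part: "{a \<in> set w. f a = i} = A i" if "i \<in> {1..m}" for i
        using w(2) perm[OF that] that permutations_of_setD(1)[of "L i" "A i"]
        by (metis set_filter)
      have range: "f a \<in> {1..m}" if "a \<in> set w" for a
        using c that unfolding w(1)[symmetric] by (auto simp: color_words_def)
      have set: "set w = ground m A"
        unfolding ground_def using part range by blast
      have "distinct w"
        using len set ground(1) by (simp add: card_distinct)
      then have "w \<in> class_words m n A"
        using set succ_iff[of w] ends_iff[of w] c \<open>w \<noteq> []\<close> unfolding w(1)[symmetric]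
        by (auto simp: W color_words_def)
      moreover have "(\<lambda>i\<in>{1..m}. filter (\<lambda>a. f a = i) w) = L"
        using L w(2) unfolding P_def by (intro extensionalityI[of _ "{1..m}"]) (auto simp: PiE_def)
      then have "F w = z" by (simp add: F_def z w(1))
      ultimately show "z \<in> F ` class_words m n A" by blast
    qed
  qed
  then have "card (class_words m n A) = card (color_words m n) * card P"
    by (simp add: bij_betw_same_card card_cartesian_product)
  also have "card P = (\<Prod>i\<in>{1..m}. card (permutations_of_set (A i)))"
    unfolding P_def by (rule card_PiE) simp
  also have "\<dots> = (\<Prod>i\<in>{1..m}. fact n)"
    by (rule prod.cong) (simp_all add: ground(2) cardA)
  finally show ?thesis by simp
qed

section \<open>Traversals of a cycle\<close>

text \<open>Rotation by \<open>k\<close> shifts indices modulo the length, so the edge at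
  \<open>t\<close> becomes the edge of \<open>p\<close> at \<open>k + t\<close>.\<close>

lemma closed_edges_rotate: "closed_edges (rotate k p) = closed_edges p"
proof -
  have sub: "closed_edges (rotate k p) \<subseteq> closed_edges p" for k and p :: "'v list"
  proof
    fix e assume "e \<in> closed_edges (rotate k p)"
    then obtain t where t: "t < length p"
      and e: "e = {rotate k p ! t, rotate k p ! (Suc t mod length p)}"
      unfolding closed_edges_def by auto
    then have "p \<noteq> []" by auto
    with t e have "e = {p ! ((k + t) mod length p), p ! (Suc ((k + t) mod length p) mod length p)}"
      by (simp add: nth_rotate mod_simps)
    moreover have "(k + t) mod length p < length p" using \<open>p \<noteq> []\<close> by simp
    ultimately show "e \<in> closed_edges p"
      unfolding closed_edges_def by blast
  qed
  have "closed_edges p \<subseteq> closed_edges (rotate k p)"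
  proof (cases "p = []")
    case False
    \<comment> \<open>For the converse, \<open>p\<close> is itself a rotation of
      \<open>rotate k p\<close>; \<open>k\<close> is reduced first because it may exceed the
      length.\<close>
    have "rotate (length p - k mod length p) (rotate (k mod length p) p) = p"
      using False mod_less_divisor[of "length p" k] by (simp add: rotate_rotate del: mod_less_divisor)
    then show ?thesis
      using sub[of "length p - k mod length p" "rotate (k mod length p) p"]
      by (simp add: rotate_conv_mod[symmetric])
  qed simp
  with sub show ?thesis by blast
qed

text \<open>Reversal takes the edge at \<open>t\<close> to the edge at
  \<open>length p - 2 - t\<close> and fixes the closing edge. As \<open>rev\<close> is an
  involution, one inclusion suffices.\<close>

lemma closed_edges_rev: "closed_edges (rev p) = closed_edges p"
proof -
  have sub: "closed_edges (rev p) \<subseteq> closed_edges p" for p :: "'v list"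
  proof
    fix e assume "e \<in> closed_edges (rev p)"
    then obtain t where t: "t < length p"
      and e: "e = {rev p ! t, rev p ! (Suc t mod length p)}"
      unfolding closed_edges_def by auto
    show "e \<in> closed_edges p"
    proof (cases "Suc t < length p")
      case True
      then have "e = {p ! (length p - Suc (Suc t)), p ! (Suc (length p - Suc (Suc t)) mod length p)}"
        using e t by (auto simp: rev_nth Suc_diff_Suc)
      with True show ?thesis
        unfolding closed_edges_def
        by (intro CollectI exI[of _ "length p - Suc (Suc t)"]) auto
    next
      case False
      then have "Suc t = length p" using t by simp
      moreover have "rev p ! 0 = p ! (length p - 1)" "rev p ! t = p ! (length p - Suc t)"
        using t rev_nth[of 0 p] rev_nth[of t p] by fastforce+
      ultimately have "e = {p ! (length p - 1), p ! (Suc (length p - 1) mod length p)}"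
        using e by (auto simp flip: \<open>Suc t = length p\<close>)
      with t show ?thesis
        unfolding closed_edges_def
        by (intro CollectI exI[of _ "length p - 1"]) auto
    qed
  qed
  show ?thesis
    using sub[of p] sub[of "rev p"] by auto
qed

text \<open>By induction, the vertex after \<open>p ! Suc j\<close> in \<open>q\<close> is one of
  its two neighbours along \<open>p\<close>. One of them is \<open>p ! j\<close>, which
  \<open>q\<close> has just visited, so distinctness leaves only the next vertex of
  \<open>p\<close>.\<close>

lemma closed_edges_determined:
  assumes "distinct p" "distinct q" "length q = length p" "closed_edges q \<subseteq> closed_edges p"
    "q ! 0 = p ! 0" "q ! 1 = p ! 1"
  shows "q = p"
proof (rule nth_equalityI)
  have "i < length p \<Longrightarrow> q ! i = p ! i" for i
  proof (induction i rule: less_induct)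
    case (less i)
    show ?case
    proof (cases "i < 2")
      case True
      then show ?thesis using assms(5,6) by (cases i) auto
    next
      case False
      then obtain j where i: "i = Suc (Suc j)"
        by (metis One_nat_def Suc_1 less_2_cases_iff not0_implies_Suc)
      have IH: "q ! j = p ! j" "q ! Suc j = p ! Suc j"
        using less i by auto
      have "{q ! Suc j, q ! (Suc (Suc j) mod length q)} \<in> closed_edges q"
        unfolding closed_edges_def using less.prems i assms(3)
        by (intro CollectI exI[of _ "Suc j"]) auto
      then have "{p ! Suc j, q ! i} \<in> closed_edges p"
        using less.prems i assms(3,4) IH by auto
      then obtain t where t: "t < length p" "{p ! Suc j, q ! i} = {p ! t, p ! (Suc t mod length p)}"
        unfolding closed_edges_def by blast
      from t(2) consider "p ! Suc j = p ! t" "q ! i = p ! (Suc t mod length p)"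
        | "p ! Suc j = p ! (Suc t mod length p)" "q ! i = p ! t"
        by (auto simp: doubleton_eq_iff)
      then show ?thesis
      proof cases
        case 1
        then have "t = Suc j"
          using assms(1) t(1) less.prems i nth_eq_iff_index_eq[of p "Suc j" t] by simp
        then show ?thesis using 1 i less.prems by simp
      next
        case 2
        then have "Suc t mod length p = Suc j"
          using assms(1) t(1) less.prems i
            nth_eq_iff_index_eq[of p "Suc j" "Suc t mod length p"]
            mod_less_divisor[of "length p" "Suc t"] by linarith
        \<comment> \<open>At \<open>Suc t = length p\<close> the remainder would be 0, which is not
          \<open>Suc j\<close>.\<close>
        then have "t = j"
          using t(1) by (cases "Suc t = length p") auto
        then have "q ! i = q ! j" using 2 IH by simp
        then show ?thesis
          using assms(2,3) less.prems i nth_eq_iff_index_eq[of q i j] by simp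
      qed
    qed
  qed
  then show "\<And>i. i < length q \<Longrightarrow> q ! i = p ! i"
    using assms(3) by simp
qed (use assms(3) in simp)

text \<open>Two steps forward return to the start only on a cycle of length at most 2. This keeps
  the two orientations of a cycle apart.\<close>

lemma Suc_Suc_mod_neq:
  fixes N t :: nat
  assumes "N \<ge> 3" "t < N"
  shows "Suc (Suc t mod N) mod N \<noteq> t"
  using assms by (auto simp: mod_Suc)

lemma card_traversals:
  assumes p: "distinct p" and N: "length p \<ge> 3"
  shows "card {q. distinct q \<and> set q = set p \<and> closed_edges q = closed_edges p} = 2 * length p"
proof -
  let ?N = "length p"
  define Q where "Q = {q. distinct q \<and> set q = set p \<and> closed_edges q = closed_edges p}"
  define s where "s t = Suc t mod ?N" for t
  \<comment> \<open>\<open>D\<close> and \<open>D'\<close> hold the ordered pairs of neighbours in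
    the forward and the backward orientation. Rotations of \<open>p\<close> realize the former as
    first two entries, reversed rotations the latter.\<close>
  define D where "D = (\<lambda>t. (p ! t, p ! s t)) ` {..<?N}"
  define D' where "D' = (\<lambda>t. (p ! s t, p ! t)) ` {..<?N}"
  have s_less: "s t < ?N" for t
    unfolding s_def using N by (intro mod_less_divisor) linarith
  have nth_eq: "p ! i = p ! j \<longleftrightarrow> i = j" if "i < ?N" "j < ?N" for i j
    using nth_eq_iff_index_eq[OF p that] .
  have len: "length q = ?N" if "q \<in> Q" for q
    using that distinct_card[of q] distinct_card[OF p] by (simp add: Q_def)
  have rotQ: "rotate k p \<in> Q" for k
    using p by (simp add: Q_def closed_edges_rotate)
  have revQ: "rev (rotate k p) \<in> Q" for k
    using p by (simp add: Q_def closed_edges_rotate closed_edges_rev)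
  have "bij_betw (\<lambda>q. (q ! 0, q ! 1)) Q (D \<union> D')"
  proof (rule bij_betw_imageI)
    show "inj_on (\<lambda>q. (q ! 0, q ! 1)) Q"
    proof (rule inj_onI)
      fix q r assume "q \<in> Q" "r \<in> Q" "(q ! 0, q ! 1) = (r ! 0, r ! 1)"
      then show "q = r"
        by (intro closed_edges_determined) (auto simp: len, auto simp: Q_def)
    qed
    show "(\<lambda>q. (q ! 0, q ! 1)) ` Q = D \<union> D'"
    proof (intro equalityI subsetI)
      fix z assume "z \<in> (\<lambda>q. (q ! 0, q ! 1)) ` Q"
      then obtain q where q: "q \<in> Q" and z: "z = (q ! 0, q ! 1)" by blast
      have "{q ! 0, q ! (Suc 0 mod length q)} \<in> closed_edges q"
        unfolding closed_edges_def using len[OF q] N by (intro CollectI exI[of _ 0]) auto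
      then have "{q ! 0, q ! 1} \<in> closed_edges p"
        using len[OF q] N q by (simp add: Q_def)
      then obtain t where "t < ?N" "{q ! 0, q ! 1} = {p ! t, p ! s t}"
        unfolding closed_edges_def s_def by blast
      then show "z \<in> D \<union> D'"
        unfolding z D_def D'_def by (auto simp: doubleton_eq_iff)
    next
      fix z assume "z \<in> D \<union> D'"
      then consider t where "t < ?N" "z = (p ! t, p ! s t)" | t where "t < ?N" "z = (p ! s t, p ! t)"
        unfolding D_def D'_def by blast
      then show "z \<in> (\<lambda>q. (q ! 0, q ! 1)) ` Q"
      proof cases
        case 1
        then have "z = (rotate t p ! 0, rotate t p ! 1)"
          using nth_rotate[of 0 p t] nth_rotate[of 1 p t] N by (fastforce simp: s_def)
        then show ?thesis using rotQ by blast
      next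
        case 2
        \<comment> \<open>Rotating by \<open>t + 2\<close> moves the entries at \<open>t\<close> and
          \<open>s t\<close> to the end, so the reversal begins with
          \<open>p ! s t, p ! t\<close>.\<close>
        let ?r = "rotate (Suc (Suc t)) p"
        have "rev ?r ! 0 = ?r ! (?N - 1)" "rev ?r ! 1 = ?r ! (?N - 2)"
          using rev_nth[of 0 ?r] rev_nth[of 1 ?r] N by (fastforce simp: numeral_2_eq_2)+
        moreover have "?r ! (?N - 1) = p ! ((Suc (Suc t) + (?N - 1)) mod ?N)"
          "?r ! (?N - 2) = p ! ((Suc (Suc t) + (?N - 2)) mod ?N)"
          using N by (intro nth_rotate; linarith)+
        moreover have "Suc (Suc t) + (?N - 1) = Suc t + ?N" "Suc (Suc t) + (?N - 2) = t + ?N"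
          using N by auto
        ultimately have "rev ?r ! 0 = p ! ((Suc t + ?N) mod ?N)" "rev ?r ! 1 = p ! ((t + ?N) mod ?N)"
          by (simp_all only:)
        then have "z = (rev ?r ! 0, rev ?r ! 1)"
          using 2 by (simp only: mod_add_self2 mod_less s_def)
        then show ?thesis using revQ by blast
      qed
    qed
  qed
  then have "card Q = card (D \<union> D')" by (rule bij_betw_same_card)
  also have "\<dots> = card D + card D'"
  proof (rule card_Un_disjoint)
    \<comment> \<open>A common pair would give \<open>t = s u\<close> and \<open>s t = u\<close>, so
      two steps from \<open>u\<close> would lead back to \<open>u\<close>.\<close>
    have False if "t < ?N" "u < ?N" "p ! t = p ! s u" "p ! s t = p ! u" for t u
      using that Suc_Suc_mod_neq[OF N, of u] s_less by (auto simp: nth_eq s_def)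
    then show "D \<inter> D' = {}" unfolding D_def D'_def by blast
  qed (simp_all add: D_def D'_def)
  also have "card D = ?N"
    unfolding D_def by (subst card_image) (auto intro!: inj_onI simp: nth_eq)
  also have "card D' = ?N"
    unfolding D'_def by (subst card_image) (auto intro!: inj_onI simp: nth_eq)
  finally show ?thesis by (simp add: Q_def)
qed

section \<open>Hamiltonian paths and cycles\<close>

text \<open>An unordered pair can be read in two orders; symmetry of \<open>in_diff_classes\<close>
  makes both readings agree.\<close>

lemma multipartite_edge_iff: "{u, v} \<in> multipartite_edges m V \<longleftrightarrow> in_diff_classes m V u v"
  unfolding multipartite_edges_def mem_Collect_eq doubleton_eq_iff
  by (metis in_diff_classes_sym)

lemma open_ham_paths_eq_class_words:
  assumes "n \<ge> 1" "equal_classes m n V"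
  shows "open_ham_paths m V = class_words m n V"
  unfolding open_ham_paths_def directed_ham_path_def class_words_eq[OF assms] multipartite_edge_iff
  by auto

text \<open>The indices below \<open>length p - 1\<close> give the consecutive pairs; the last index
  gives the closing edge, which is the condition on the endpoints.\<close>

lemma closed_edges_subset_iff:
  assumes "p \<noteq> []"
  shows "closed_edges p \<subseteq> multipartite_edges m V \<longleftrightarrow>
    successively (in_diff_classes m V) p \<and> in_diff_classes m V (hd p) (last p)"
proof -
  have "closed_edges p \<subseteq> multipartite_edges m V \<longleftrightarrow>
    (\<forall>t<length p. in_diff_classes m V (p ! t) (p ! (Suc t mod length p)))"
    unfolding closed_edges_def by (auto simp flip: multipartite_edge_iff)
  also have "\<dots> \<longleftrightarrow> (\<forall>t. Suc t < length p \<longrightarrow> in_diff_classes m V (p ! t) (p ! Suc t)) \<and>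
    in_diff_classes m V (p ! (length p - 1)) (p ! 0)" (is "?L \<longleftrightarrow> ?R")
  proof
    assume L: ?L
    have "in_diff_classes m V (p ! t) (p ! Suc t)" if "Suc t < length p" for t
      using L[rule_format, of t] that by simp
    moreover have "in_diff_classes m V (p ! (length p - 1)) (p ! 0)"
      using L[rule_format, of "length p - 1"] assms by simp
    ultimately show ?R by blast
  next
    assume R: ?R
    show ?L
    proof (intro allI impI)
      fix t assume "t < length p"
      then consider "Suc t < length p" | "t = length p - 1" by linarith
      then show "in_diff_classes m V (p ! t) (p ! (Suc t mod length p))"
        using R assms by cases auto
    qed
  qed
  also have "in_diff_classes m V (p ! (length p - 1)) (p ! 0) \<longleftrightarrow>
    in_diff_classes m V (p ! 0) (p ! (length p - 1))"
    by (rule iffI; erule in_diff_classes_sym)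
  finally show ?thesis
    using assms by (simp add: successively_conv_nth hd_conv_nth last_conv_nth)
qed

text \<open>Distinct parts at the two ends mean exactly that the closing edge exists. A nonempty
  ground set excludes the empty list, whose \<open>hd\<close> and \<open>last\<close> are
  unspecified.\<close>

lemma open_ham_paths_iff_closed_edges:
  assumes "ground m V \<noteq> {}"
  shows "p \<in> open_ham_paths m V \<longleftrightarrow>
    distinct p \<and> set p = ground m V \<and> closed_edges p \<subseteq> multipartite_edges m V"
proof (cases "p = []")
  case True
  then show ?thesis using assms by (auto simp: open_ham_paths_def directed_ham_path_def)
next
  case False
  then show ?thesis
    by (auto simp: open_ham_paths_def directed_ham_path_def closed_edges_subset_iff
        multipartite_edge_iff)
qed

text \<open>Fix one traversal \<open>p\<close> of \<open>C\<close>. Since \<open>C\<close> lies in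
  the graph, every distinct sequence on the same vertices with the same closed edges is an open
  path, so \<open>card_traversals\<close> counts the fibre.\<close>

lemma card_ham_cycle_traversals:
  assumes "ground m V \<noteq> {}" "C \<in> ham_cycles m V"
  shows "card {p \<in> open_ham_paths m V. closed_edges p = C} = 2 * card (ground m V)"
proof -
  obtain p where p: "distinct p" "set p = ground m V" "length p \<ge> 3"
    "closed_edges p \<subseteq> multipartite_edges m V" "C = closed_edges p"
    using assms(2) unfolding ham_cycles_def undirected_ham_cycle_def by blast
  have "{q \<in> open_ham_paths m V. closed_edges q = C} =
    {q. distinct q \<and> set q = set p \<and> closed_edges q = closed_edges p}"
    using p by (auto simp: open_ham_paths_iff_closed_edges[OF assms(1)])
  then show ?thesis
    using card_traversals[OF p(1,3)] distinct_card[OF p(1)] p(2) by simp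
qed

text \<open>Only the requirement of three vertices separates closed edge sets of open paths from
  cycles. It fails for \<open>(2, 1)\<close>, where two vertices joined by an edge have open paths
  but no cycle.\<close>

lemma ham_cycles_eq_image:
  assumes "m \<ge> 1" "n \<ge> 1" "equal_classes m n V" "(m, n) \<noteq> (2, 1)"
  shows "ham_cycles m V = closed_edges ` open_ham_paths m V"
proof -
  have card: "card (ground m V) = m * n" using ground_props[OF assms(2,3)] by simp
  then have ne: "ground m V \<noteq> {}" using assms(1,2) by auto
  have "length p \<ge> 3" if "p \<in> open_ham_paths m V" for p
  proof -
    have "length p = m * n"
      using that card distinct_card[of p] by (simp add: open_ham_paths_iff_closed_edges[OF ne])
    moreover have "m \<noteq> 1"
      using that by (auto simp: open_ham_paths_def in_diff_classes_def)
    \<comment> \<open>An open path forces \<open>m\<close> to be at least 2. For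
      \<open>n = 1\<close> the excluded pair leaves \<open>m\<close> at least 3; otherwise the
      product is at least 4.\<close>
    then have "m * n \<ge> 3"
      using assms(1,2,4) mult_le_mono[of 2 m 2 n] by (cases "n = 1") auto
    ultimately show ?thesis by simp
  qed
  then show ?thesis
    unfolding ham_cycles_def undirected_ham_cycle_def image_def
    using open_ham_paths_iff_closed_edges[OF ne] by blast
qed

theorem mainTheorem5:
  fixes m n :: nat and A :: "nat \<Rightarrow> 'a set" and V :: "nat \<Rightarrow> 'v set"
  assumes "m \<ge> 1" and "n \<ge> 1"
    and "equal_classes m n A" and "equal_classes m n V"
  shows "(\<exists>f. bij_betw f (class_words m n A) (open_ham_paths m V)) \<and>
    (\<forall>C\<in>ham_cycles m V. card {p \<in> open_ham_paths m V. closed_edges p = C} = 2 * m * n) \<and>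
    ((m, n) \<noteq> (2, 1) \<longrightarrow>
      real (card (ham_cycles m V)) = real (card (class_words m n A)) / real (2 * m * n)) \<and>
    real (card (class_words m n A)) / real (2 * m * n)
      = fact n ^ m / real (2 * m * n) * real (card (color_words m n))"
proof (intro conjI impI)
  note paths = open_ham_paths_eq_class_words[OF assms(2,4)]
  have fin: "finite (open_ham_paths m V)"
    using finite_class_words[OF assms(2,4)] paths by simp
  \<comment> \<open>By the colour-word formula, the number of words depends only on \<open>m\<close>
    and \<open>n\<close>, so the alphabet \<open>A\<close> may be exchanged for the vertex family
    \<open>V\<close>.\<close>
  have card_eq: "card (class_words m n A) = card (open_ham_paths m V)"
    unfolding paths using card_class_words[OF assms(1,2)] assms(3,4) by metis
  show "\<exists>f. bij_betw f (class_words m n A) (open_ham_paths m V)"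
    using finite_same_card_bij[OF finite_class_words[OF assms(2,3)] fin card_eq] by blast
  have ground: "card (ground m V) = m * n" using ground_props[OF assms(2,4)] by simp
  then have "ground m V \<noteq> {}" using assms(1,2) by auto
  then show fibres:
    "\<forall>C\<in>ham_cycles m V. card {p \<in> open_ham_paths m V. closed_edges p = C} = 2 * m * n"
    using card_ham_cycle_traversals ground by (metis mult.assoc)
  show "real (card (ham_cycles m V)) = real (card (class_words m n A)) / real (2 * m * n)"
    if "(m, n) \<noteq> (2, 1)"
  proof -
    \<comment> \<open>Double counting: the open paths are partitioned by the cycle they traverse,
      and every fibre has \<open>2 * m * n\<close> elements.\<close>
    have "card (open_ham_paths m V) =
      (\<Sum>C\<in>ham_cycles m V. card {p \<in> open_ham_paths m V. closed_edges p = C})"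
      unfolding ham_cycles_eq_image[OF assms(1,2,4) that] card_eq_sum
      by (rule sum.image_gen[OF fin])
    also have "\<dots> = card (ham_cycles m V) * (2 * m * n)"
      using fibres by simp
    finally show ?thesis
      using assms(1,2) card_eq by (simp add: field_simps)
  qed
  show "real (card (class_words m n A)) / real (2 * m * n)
      = fact n ^ m / real (2 * m * n) * real (card (color_words m n))"
    using card_class_words[OF assms(1-3)] by simp
qed

end
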